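(* Let $f:\mathbb{R}^n\to\mathbb{R}$ satisfy: (AS.1) $f$ is twice continuously differentiable on $\mathbb{R}^n$, and $\nabla f$ and $\nabla^2 f$ are Lipschitz continuous on $\mathbb{R}^n$ with constants $L_1$ and $L_2$, respectively; (AS.2) there is a constant $f_{\rm low}$ with $f(x)\ge f_{\rm low}$ for all $x\in\mathbb{R}^n$. Fix the starting point $x_0$ and the constants of the FAR2 algorithm, and set $$\sigma_{\max}=\max\left\{\sigma_0,\ \gamma_2\frac{L_2C_{\rm up}}{3(1-\eta_1)},\ \gamma_2\frac{L_2}{2(1-\eta_1)}\right\}.$$ Then there exists a constant $\kappa_p>0$, independent of $\epsilon$, such that for every $\epsilon\in(0,1)$ the FAR2 algorithm needs at most $$\left\lceil \frac{f(x_0)-f_{\rm low}}{\kappa_p}\,\epsilon^{-3/2}+1\right\rceil$$ successful iterations and at most $$\left\lceil \frac{f(x_0)-f_{\rm low}}{\kappa_p}\,\epsilon^{-3/2}+1\right\rceil\left(\frac32+\frac{3}{2}\,\frac{|\log\gamma_1|}{\log\gamma_2}\right)+\frac{3}{2\log\gamma_2}\log\left(\frac{\sigma_{\max}}{\sigma_0}\right)$$ iterations to compute an iterate $x_k$ such that $\|\nabla f(x_k)\|\le\epsilon$.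
   Context: $\|\cdot\|$ is the Euclidean norm for vectors (spectral norm for matrices), $I$ the identity. For iterates $x_k$ put $g_k=\nabla f(x_k)$, $H_k=\nabla^2 f(x_k)$, $$T_k(s)=f(x_k)+s^Tg_k+\tfrac12 s^TH_ks,\qquad m_k(s)=T_k(s)+\tfrac13\sigma_k\|s\|^3 .$$ The FAR2 algorithm. Constants: $\epsilon\in(0,1)$, $\sigma_0>0$, $\sigma_{\min}\in(0,\sigma_0]$, $\theta_1>0$, $0<\eta_1\le\eta_2<1$, $0<\gamma_1<1<\gamma_2$, $0<C_{\rm low}<C_{\rm up}$, an integer $j_{\max}\ll n$ ($j_{\max}\ge 2$); initial point $x_0$. Initialize $k=0$, $\mathtt{refresh}=1$, $V_0$ the empty matrix. Iteration $k$: Step 1. If $\|g_k\|\le\epsilon$, terminate. Step 2 (step computation). (a) Subspace minimization, producing $\widehat\lambda_k,\widehat s_k,W_k,V_{k+1}$. If $\mathtt{refresh}=1$: start with $V_{k+1}$ empty; for $j=1,\dots,j_{\max}-1$: let $W^{(j)}$ have orthonormal columns spanning the range of $[V_{k+1},g_k]$; set $g^{(j)}=(W^{(j)})^Tg_k$, $H^{(j)}=(W^{(j)})^TH_kW^{(j)}$; find $\widehat\lambda\ge 0$ with $H^{(j)}+\widehat\lambda I$ positive definite and $\widehat\lambda=\sigma_k\|(H^{(j)}+\widehat\lambda I)^{-1}g^{(j)}\|$; set $\widehat s=-(H^{(j)}+\widehat\lambda I)^{-1}g^{(j)}$; if $\|\nabla m_k(W^{(j)}\widehat s)\|\le\frac12\theta_1\|\widehat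 s\|^2$ exit the loop; otherwise append a new basis vector (any choice, keeping the columns orthonormal) to $V_{k+1}$. Output the last computed $\widehat\lambda_k=\widehat\lambda$, $\widehat s_k=\widehat s$, $W_k=W^{(j)}$. If $\mathtt{refresh}=0$: let $W_k$ have orthonormal columns spanning the range of $[V_k,g_k]$, compute $\widehat\lambda_k,\widehat s_k$ in the same way from the projections of $g_k,H_k$ by $W_k$, and set $V_{k+1}=V_k$. Thus $\widehat s_k$ gives the global minimizer $W_k\widehat s_k$ of $m_k$ over the range of $W_k$ (which contains $g_k$) and $\widehat\lambda_k=\sigma_k\|\widehat s_k\|$. (b) If $\|\nabla m_k(W_k\widehat s_k)\|\le\frac12\theta_1\|W_k\widehat s_k\|^2$, set $s_k=W_k\widehat s_k$ and go to Step 3. (c) Otherwise compute the regularized Newton step $s_k=-(H_k+\widehat\lambda_kI)^{-1}g_k$. (d) If $s_k^T(H_k+\widehat\lambda_kI)s_k\le0$ or $\|s_k\|/\|\widehat s_k\|<C_{\rm low}$ or $\|s_k\|/\|\widehat s_k\|>C_{\rm up}$: if $\mathtt{refresh}=1$, recompute $\lambda_k$ and $s_k=-(H_k+\lambda_kI)^{-1}g_k$ such that $m_k(s_k)<m_k(0)$ and $\|\nabla m_k(s_k)\|\le\frac12\theta_1\|s_k\|^2$ (by the secant method applied to $\|(H_k+\lambda I)^{-1}g_k\|-\lambda/\sigma_k=0$) and go to Step 3; if $\mathtt{refresh}=0$, the iteration is unsuccessful: set $x_{k+1}=x_k$, $\sigma_{k+1}=\sigma_k$, $\mathtt{refresh}=1$,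 increase $k$ by one and go to Step 1. Step 3. Compute $\rho_k=\dfrac{f(x_k)-f(x_k+s_k)}{T_k(0)-T_k(s_k)}$. Step 4. If $\rho_k\ge\eta_1$ the iteration is successful and $x_{k+1}=x_k+s_k$; otherwise it is unsuccessful and $x_{k+1}=x_k$. Step 5. Choose $\sigma_{k+1}\in[\max\{\sigma_{\min},\gamma_1\sigma_k\},\sigma_k]$ if $\rho_k\ge\eta_2$; $\sigma_{k+1}=\sigma_k$ if $\rho_k\in[\eta_1,\eta_2)$; $\sigma_{k+1}=\gamma_2\sigma_k$ otherwise. Set $\mathtt{refresh}=0$, increase $k$ by one, go to Step 1. It is understood that every computation requested by the algorithm can be carried out (i.e. the algorithm is well defined along the run considered). *)

theory Defs
  imports "HOL-Analysis.Analysis" "Jordan_Normal_Form.Matrix"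
begin

no_notation scalar_prod (infix \<open>\<bullet>\<close> 70)

section \<open>Smooth functions\<close>

definition grad :: "(real^'n \<Rightarrow> real) \<Rightarrow> real^'n \<Rightarrow> real^'n" where
  "grad f x = (THE g. GDERIV f x :> g)"

definition hess :: "(real^'n \<Rightarrow> real) \<Rightarrow> real^'n \<Rightarrow> real^'n^'n" where
  "hess f x = matrix (frechet_derivative (grad f) (at x))"

definition twice_cont_differentiable :: "(real^'n \<Rightarrow> real) \<Rightarrow> bool" where
  "twice_cont_differentiable f \<longleftrightarrow>
     (\<forall>x. f differentiable at x) \<and> (\<forall>x. grad f differentiable at x) \<and>
     continuous_on UNIV (hess f)"

text \<open>The norm of the type of matrices is the Frobenius norm, so the spectral norm
  is introduced separately.\<close>

definition spectral_norm :: "real^'n^'n \<Rightarrow> real" where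
  "spectral_norm A = onorm (\<lambda>v. A *v v)"

definition AS1 :: "(real^'n \<Rightarrow> real) \<Rightarrow> real \<Rightarrow> real \<Rightarrow> bool" where
  "AS1 f L1 L2 \<longleftrightarrow>
     twice_cont_differentiable f \<and>
     (\<forall>x y. norm (grad f x - grad f y) \<le> L1 * norm (x - y)) \<and>
     (\<forall>x y. spectral_norm (hess f x - hess f y) \<le> L2 * norm (x - y))"

definition AS2 :: "(real^'n \<Rightarrow> real) \<Rightarrow> real \<Rightarrow> bool" where
  "AS2 f f_low \<longleftrightarrow> (\<forall>x. f_low \<le> f x)"


section \<open>Models\<close>

definition quad_model :: "(real^'n \<Rightarrow> real) \<Rightarrow> real^'n \<Rightarrow> real^'n \<Rightarrow> real" where
  "quad_model f x s = f x + s \<bullet> grad f x + 1/2 * (s \<bullet> (hess f x *v s))"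

definition cubic_model :: "(real^'n \<Rightarrow> real) \<Rightarrow> real^'n \<Rightarrow> real \<Rightarrow> real^'n \<Rightarrow> real" where
  "cubic_model f x \<sigma> s = quad_model f x s + 1/3 * \<sigma> * norm s ^ 3"


section \<open>Matrices with a variable number of columns\<close>

text \<open>The number \<open>p\<close> of columns of \<open>V\<^sub>k\<close> and \<open>W\<^sub>k\<close> changes during a run. An
  \<open>n \<times> p\<close> matrix is the list of its \<open>p\<close> columns in \<open>\<real>\<^sup>n\<close>, whereas vectors of \<open>\<real>\<^sup>p\<close>
  and \<open>p \<times> p\<close> matrices are those of the theory \<open>Jordan_Normal_Form.Matrix\<close>.\<close>

type_synonym 'n cols = "(real^'n) list"

definition orthonormal_cols :: "'n::finite cols \<Rightarrow> bool" where
  "orthonormal_cols W \<longleftrightarrow>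
     (\<forall>i<length W. \<forall>j<length W. W ! i \<bullet> W ! j = (if i = j then 1 else 0))"

definition orthonormal_basis_of_range :: "'n::finite cols \<Rightarrow> 'n cols \<Rightarrow> bool" where
  "orthonormal_basis_of_range W A \<longleftrightarrow> orthonormal_cols W \<and> span (set W) = span (set A)"

text \<open>The products \<open>W v\<close>, \<open>W\<^sup>T g\<close> and \<open>W\<^sup>T H W\<close>.\<close>

definition cols_mult :: "'n::finite cols \<Rightarrow> real Matrix.vec \<Rightarrow> real^'n" where
  "cols_mult W v = (\<Sum>i<length W. vec_index v i *\<^sub>R W ! i)"

definition proj_vec :: "'n::finite cols \<Rightarrow> real^'n \<Rightarrow> real Matrix.vec" where
  "proj_vec W g = Matrix.vec (length W) (\<lambda>i. W ! i \<bullet> g)"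

definition proj_mat :: "'n::finite cols \<Rightarrow> real^'n^'n \<Rightarrow> real Matrix.mat" where
  "proj_mat W H = Matrix.mat (length W) (length W) (\<lambda>(i, j). W ! i \<bullet> (H *v W ! j))"

definition euclid_norm :: "real Matrix.vec \<Rightarrow> real" where
  "euclid_norm v = sqrt (scalar_prod v v)"

text \<open>Symmetry is not part of the definition; it is only applied to matrices derived from
  Hessians of twice continuously differentiable functions.\<close>

definition positive_definite :: "nat \<Rightarrow> real Matrix.mat \<Rightarrow> bool" where
  "positive_definite p A \<longleftrightarrow>
     A \<in> carrier_mat p p \<and>
     (\<forall>v \<in> carrier_vec p. v \<noteq> 0\<^sub>v p \<longrightarrow> 0 < scalar_prod v (A *\<^sub>v v))"


section \<open>The algorithm\<close>

record far2_params =
  sigma0 :: real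
  sigma_min :: real
  theta1 :: real
  eta1 :: real
  eta2 :: real
  gamma1 :: real
  gamma2 :: real
  C_low :: real
  C_up :: real
  j_max :: nat

definition valid_params :: "'n::finite itself \<Rightarrow> far2_params \<Rightarrow> bool" where
  "valid_params _ P \<longleftrightarrow>
     0 < sigma0 P \<and> 0 < sigma_min P \<and> sigma_min P \<le> sigma0 P \<and>
     0 < theta1 P \<and>
     0 < eta1 P \<and> eta1 P \<le> eta2 P \<and> eta2 P < 1 \<and>
     0 < gamma1 P \<and> gamma1 P < 1 \<and> 1 < gamma2 P \<and>
     0 < C_low P \<and> C_low P < C_up P \<and>
     2 \<le> j_max P \<and> j_max P < CARD('n)"

record 'n far2_state =
  iterate :: "real^'n"
  sigma :: real
  refresh :: bool
  basis :: "'n cols"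

text \<open>The pair \<open>lam, s\<close> (with a hat in the algorithm) computed from the projections of \<open>g\<close>
  and \<open>H\<close> by \<open>W\<close>; the matrix \<open>B\<close> is the inverse of \<open>W\<^sup>T H W + lam I\<close>.\<close>

definition reduced_solution ::
  "real^'n \<Rightarrow> real^'n^'n \<Rightarrow> real \<Rightarrow> 'n::finite cols \<Rightarrow> real \<Rightarrow> real Matrix.vec \<Rightarrow> bool" where
  "reduced_solution g H \<sigma> W lam s \<longleftrightarrow>
     (let p = length W; A = proj_mat W H + lam \<cdot>\<^sub>m 1\<^sub>m p in
        0 \<le> lam \<and> positive_definite p A \<and>
        (\<exists>B \<in> carrier_mat p p. inverts_mat A B \<and> inverts_mat B A \<and>
           lam = \<sigma> * euclid_norm (B *\<^sub>v proj_vec W g) \<and>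
           s = - (B *\<^sub>v proj_vec W g)))"

text \<open>\<open>refresh_loop P f x \<sigma> j V lam s W V'\<close>: the loop entered at index \<open>j\<close> with columns \<open>V\<close>
  may output \<open>lam, s, W\<close> and end with columns \<open>V'\<close>.\<close>

inductive refresh_loop ::
  "far2_params \<Rightarrow> (real^'n \<Rightarrow> real) \<Rightarrow> real^'n \<Rightarrow> real \<Rightarrow> nat \<Rightarrow> 'n::finite cols \<Rightarrow>
   real \<Rightarrow> real Matrix.vec \<Rightarrow> 'n cols \<Rightarrow> 'n cols \<Rightarrow> bool"
  for P f x \<sigma> where
  exit_loop:
    "\<lbrakk>j \<le> j_max P - 1;
      orthonormal_basis_of_range W (V @ [grad f x]);
      reduced_solution (grad f x) (hess f x) \<sigma> W lam s;
      norm (grad (cubic_model f x \<sigma>) (cols_mult W s)) \<le> 1/2 * theta1 P * (euclid_norm s)\<^sup>2\<rbrakk>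
     \<Longrightarrow> refresh_loop P f x \<sigma> j V lam s W V"
| last_pass:
    "\<lbrakk>j = j_max P - 1;
      orthonormal_basis_of_range W (V @ [grad f x]);
      reduced_solution (grad f x) (hess f x) \<sigma> W lam s;
      \<not> norm (grad (cubic_model f x \<sigma>) (cols_mult W s)) \<le> 1/2 * theta1 P * (euclid_norm s)\<^sup>2;
      orthonormal_cols (V @ [v])\<rbrakk>
     \<Longrightarrow> refresh_loop P f x \<sigma> j V lam s W (V @ [v])"
| next_pass:
    "\<lbrakk>j < j_max P - 1;
      orthonormal_basis_of_range W (V @ [grad f x]);
      reduced_solution (grad f x) (hess f x) \<sigma> W lam s;
      \<not> norm (grad (cubic_model f x \<sigma>) (cols_mult W s)) \<le> 1/2 * theta1 P * (euclid_norm s)\<^sup>2;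
      orthonormal_cols (V @ [v]);
      refresh_loop P f x \<sigma> (Suc j) (V @ [v]) lam' s' W' V'\<rbrakk>
     \<Longrightarrow> refresh_loop P f x \<sigma> j V lam' s' W' V'"

definition subspace_min ::
  "far2_params \<Rightarrow> (real^'n \<Rightarrow> real) \<Rightarrow> 'n::finite far2_state \<Rightarrow>
   real \<Rightarrow> real Matrix.vec \<Rightarrow> 'n cols \<Rightarrow> 'n cols \<Rightarrow> bool" where
  "subspace_min P f S lam s W V' \<longleftrightarrow>
     (if refresh S then refresh_loop P f (iterate S) (sigma S) 1 [] lam s W V'
      else orthonormal_basis_of_range W (basis S @ [grad f (iterate S)]) \<and>
           reduced_solution (grad f (iterate S)) (hess f (iterate S)) (sigma S) W lam s \<and>
           V' = basis S)"

abbreviation shifted :: "real^'n^'n \<Rightarrow> real \<Rightarrow> real^'n^'n" where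
  "shifted H lam \<equiv> H + lam *\<^sub>R Finite_Cartesian_Product.mat 1"

definition newton_step :: "real^'n^'n \<Rightarrow> real^'n \<Rightarrow> real \<Rightarrow> real^'n \<Rightarrow> bool" where
  "newton_step H g lam s \<longleftrightarrow>
     invertible (shifted H lam) \<and> s = - (matrix_inv (shifted H lam) *v g)"

definition small_model_gradient ::
  "far2_params \<Rightarrow> (real^'n \<Rightarrow> real) \<Rightarrow> 'n::finite far2_state \<Rightarrow> real^'n \<Rightarrow> bool" where
  "small_model_gradient P f S s \<longleftrightarrow>
     norm (grad (cubic_model f (iterate S) (sigma S)) s) \<le> 1/2 * theta1 P * (norm s)\<^sup>2"

definition newton_rejected ::
  "far2_params \<Rightarrow> real^'n^'n \<Rightarrow> real \<Rightarrow> real Matrix.vec \<Rightarrow> real^'n \<Rightarrow> bool" where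
  "newton_rejected P H lam sh s \<longleftrightarrow>
     s \<bullet> (shifted H lam *v s) \<le> 0 \<or>
     norm s / euclid_norm sh < C_low P \<or> norm s / euclid_norm sh > C_up P"

text \<open>Step computation. The result is \<open>Some s\<close> if the step \<open>s\<close> is passed on to the computation
  of \<open>\<rho>\<close>, and \<open>None\<close> if the iteration is abandoned as unsuccessful; the last argument is
  \<open>V\<close> for the next iteration.\<close>

inductive compute_step ::
  "far2_params \<Rightarrow> (real^'n \<Rightarrow> real) \<Rightarrow> 'n::finite far2_state \<Rightarrow>
   (real^'n) option \<Rightarrow> 'n cols \<Rightarrow> bool"
  for P f S where
  subspace_accepted:
    "\<lbrakk>subspace_min P f S lamh sh W V';
      small_model_gradient P f S (cols_mult W sh)\<rbrakk>
     \<Longrightarrow> compute_step P f S (Some (cols_mult W sh)) V'"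
| newton_accepted:
    "\<lbrakk>subspace_min P f S lamh sh W V';
      \<not> small_model_gradient P f S (cols_mult W sh);
      newton_step (hess f (iterate S)) (grad f (iterate S)) lamh s;
      \<not> newton_rejected P (hess f (iterate S)) lamh sh s\<rbrakk>
     \<Longrightarrow> compute_step P f S (Some s) V'"
| recomputed:
    "\<lbrakk>subspace_min P f S lamh sh W V';
      \<not> small_model_gradient P f S (cols_mult W sh);
      newton_step (hess f (iterate S)) (grad f (iterate S)) lamh s';
      newton_rejected P (hess f (iterate S)) lamh sh s';
      refresh S;
      newton_step (hess f (iterate S)) (grad f (iterate S)) lam s;
      cubic_model f (iterate S) (sigma S) s < cubic_model f (iterate S) (sigma S) 0;
      small_model_gradient P f S s\<rbrakk>
     \<Longrightarrow> compute_step P f S (Some s) V'"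
| abandoned:
    "\<lbrakk>subspace_min P f S lamh sh W V';
      \<not> small_model_gradient P f S (cols_mult W sh);
      newton_step (hess f (iterate S)) (grad f (iterate S)) lamh s';
      newton_rejected P (hess f (iterate S)) lamh sh s';
      \<not> refresh S\<rbrakk>
     \<Longrightarrow> compute_step P f S None V'"

definition rho :: "(real^'n \<Rightarrow> real) \<Rightarrow> real^'n \<Rightarrow> real^'n \<Rightarrow> real" where
  "rho f x s = (f x - f (x + s)) / (quad_model f x 0 - quad_model f x s)"

definition sigma_update :: "far2_params \<Rightarrow> real \<Rightarrow> real \<Rightarrow> real \<Rightarrow> bool" where
  "sigma_update P r \<sigma> \<sigma>' \<longleftrightarrow>
     (if r \<ge> eta2 P then \<sigma>' \<in> {max (sigma_min P) (gamma1 P * \<sigma>)..\<sigma>}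
      else if r \<ge> eta1 P then \<sigma>' = \<sigma>
      else \<sigma>' = gamma2 P * \<sigma>)"

text \<open>\<open>far2_iteration P f S b S'\<close>: a full iteration may lead from state \<open>S\<close> to state \<open>S'\<close>, and
  it is successful iff \<open>b\<close>.\<close>

inductive far2_iteration ::
  "far2_params \<Rightarrow> (real^'n \<Rightarrow> real) \<Rightarrow> 'n::finite far2_state \<Rightarrow> bool \<Rightarrow> 'n far2_state \<Rightarrow> bool"
  for P f S where
  abandoned_iteration:
    "compute_step P f S None V'
     \<Longrightarrow> far2_iteration P f S False
           \<lparr>iterate = iterate S, sigma = sigma S, refresh = True, basis = V'\<rparr>"
| tested_iteration:
    "\<lbrakk>compute_step P f S (Some s) V';
      b \<longleftrightarrow> rho f (iterate S) s \<ge> eta1 P;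
      sigma_update P (rho f (iterate S) s) (sigma S) \<sigma>'\<rbrakk>
     \<Longrightarrow> far2_iteration P f S b
           \<lparr>iterate = (if b then iterate S + s else iterate S),
            sigma = \<sigma>', refresh = False, basis = V'\<rparr>"

text \<open>A run that has not terminated always continues, since all requested computations can be
  carried out; \<open>S k\<close> and \<open>succ k\<close> are irrelevant for \<open>k\<close> after termination.\<close>

definition far2_run ::
  "far2_params \<Rightarrow> (real^'n \<Rightarrow> real) \<Rightarrow> real^'n \<Rightarrow> real \<Rightarrow>
   (nat \<Rightarrow> 'n::finite far2_state) \<Rightarrow> (nat \<Rightarrow> bool) \<Rightarrow> bool" where
  "far2_run P f x0 \<epsilon> S succ \<longleftrightarrow>
     S 0 = \<lparr>iterate = x0, sigma = sigma0 P, refresh = True, basis = []\<rparr> \<and>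
     (\<forall>k. (\<forall>i\<le>k. \<not> norm (grad f (iterate (S i))) \<le> \<epsilon>) \<longrightarrow>
          far2_iteration P f (S k) (succ k) (S (Suc k)))"

definition sigma_max :: "far2_params \<Rightarrow> real \<Rightarrow> real" where
  "sigma_max P L2 = Max {sigma0 P, gamma2 P * (L2 * C_up P / (3 * (1 - eta1 P))),
                         gamma2 P * (L2 / (2 * (1 - eta1 P)))}"

end

theory Submission
  imports Defs
begin

text \<open>
  Every tested step \<open>s\<close> decreases the quadratic model by at least \<open>c \<sigma> \<parallel>s\<parallel>\<^sup>3\<close>, where
  \<open>c = min (1/3) (1 / (2 C\<^sub>u\<^sub>p))\<close>. The cubic Taylor bound then makes every iteration with large
  \<open>\<sigma>\<close> successful, which keeps \<open>\<sigma>\<close> below \<open>\<sigma>\<^sub>m\<^sub>a\<^sub>x\<close>. As moreover \<open>\<parallel>g + H s\<parallel> = O(\<parallel>s\<parallel>\<^sup>2)\<close>, a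
  successful step reaching a gradient of norm above \<open>\<epsilon>\<close> has \<open>\<parallel>s\<parallel>\<^sup>2 \<ge> \<epsilon> / K\<close> and decreases \<open>f\<close> by a
  multiple of \<open>\<epsilon>\<^sup>3\<^sup>/\<^sup>2\<close>; this bounds the number of successful iterations, and \<open>\<sigma> \<le> \<sigma>\<^sub>m\<^sub>a\<^sub>x\<close> bounds
  the number of unsuccessful tested ones in terms of it.

  An abandoned iteration is always directly preceded by a tested one, so the total is at most
  twice the number of tested iterations. The smaller factor 3/2 of the statement comes from
  the freedom in \<open>\<kappa>\<^sub>p\<close>: because \<open>\<epsilon> < 1\<close>, decreasing \<open>\<kappa>\<^sub>p\<close> (depending on \<open>f x\<^sub>0 - f\<^sub>l\<^sub>o\<^sub>w\<close> and
  \<open>\<sigma>\<^sub>m\<^sub>a\<^sub>x\<close>) absorbs the difference. If \<open>f x\<^sub>0 = f\<^sub>l\<^sub>o\<^sub>w\<close> then \<open>x\<^sub>0\<close> is already stationary.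
\<close>

section \<open>Gradients, Taylor bounds and symmetry of the Hessian\<close>

lemma GDERIV_unique:
  assumes "GDERIV f x :> g" and "GDERIV f x :> h"
  shows "g = h"
proof -
  have "(\<lambda>v. v \<bullet> g) = (\<lambda>v. v \<bullet> h)"
    using assms unfolding gderiv_def by (rule has_derivative_unique)
  then have "(g - h) \<bullet> g = (g - h) \<bullet> h" by metis
  then have "(g - h) \<bullet> (g - h) = 0" by (simp add: inner_diff_right)
  then show ?thesis by simp
qed

text \<open>Riesz representation in coordinates: the vector with components \<open>D b\<close>
  represents the derivative \<open>D\<close>, and uniqueness identifies it with the description
  defining \<open>grad\<close>.\<close>

lemma GDERIV_grad:
  fixes f :: "real^'n \<Rightarrow> real"
  assumes "f differentiable at x"
  shows "GDERIV f x :> grad f x"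
proof -
  from assms obtain D where D: "(f has_derivative D) (at x)"
    by (auto simp: differentiable_def)
  then have lin: "linear D" by (rule has_derivative_linear)
  define g where "g = (\<Sum>b\<in>Basis. D b *\<^sub>R b)"
  have "D = (\<lambda>h. h \<bullet> g)"
  proof
    fix h
    have "D h = D (\<Sum>b\<in>Basis. (h \<bullet> b) *\<^sub>R b)" by (simp add: euclidean_representation)
    also have "\<dots> = h \<bullet> g"
      by (simp add: linear_sum[OF lin] linear_scale[OF lin] g_def inner_sum_right mult.commute)
    finally show "D h = h \<bullet> g" .
  qed
  with D have g: "GDERIV f x :> g" by (simp add: gderiv_def inner_commute)
  then show ?thesis unfolding grad_def
    by (rule theI) (use g GDERIV_unique in blast)
qed

lemma grad_eqI:
  fixes f :: "real^'n \<Rightarrow> real"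
  assumes "GDERIV f x :> g"
  shows "grad f x = g"
  unfolding grad_def using assms GDERIV_unique by (intro the_equality) blast+

lemma norm_matrix_vector_le:
  fixes A :: "real^'n^'n"
  shows "norm (A *v v) \<le> spectral_norm A * norm v"
  unfolding spectral_norm_def by (rule onorm) (rule matrix_vector_mul_bounded_linear)

lemma line_has_derivative:
  fixes f :: "real^'n \<Rightarrow> real"
  assumes "\<And>x. f differentiable at x"
  shows "((\<lambda>t. f (x + t *\<^sub>R s)) has_real_derivative s \<bullet> grad f (x + t *\<^sub>R s)) (at t)"
proof -
  have "(f has_derivative (\<lambda>h. h \<bullet> grad f (x + t *\<^sub>R s))) (at (x + t *\<^sub>R s))"
    using GDERIV_grad[OF assms] by (simp add: gderiv_def inner_commute)
  then have "((\<lambda>t. f (x + t *\<^sub>R s)) has_derivative (\<lambda>h. (h *\<^sub>R s) \<bullet> grad f (x + t *\<^sub>R s))) (at t)"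
    by (rule has_derivative_compose[rotated]) (auto intro!: derivative_eq_intros)
  then show ?thesis by (simp add: has_field_derivative_def mult_commute_abs)
qed

lemma line_grad_has_derivative:
  fixes f :: "real^'n \<Rightarrow> real"
  assumes "\<And>x. grad f differentiable at x"
  shows "((\<lambda>t. v \<bullet> grad f (x + t *\<^sub>R s)) has_real_derivative v \<bullet> (hess f (x + t *\<^sub>R s) *v s)) (at t)"
proof -
  define y where "y = x + t *\<^sub>R s"
  have d: "(grad f has_derivative frechet_derivative (grad f) (at y)) (at y)"
    using assms frechet_derivative_works by blast
  have "frechet_derivative (grad f) (at y) = (\<lambda>h. hess f y *v h)"
    unfolding hess_def using has_derivative_linear[OF d]
    by (auto simp: matrix_works linear_def scalar_mult_eq_scaleR[abs_def])
  with d have "(grad f has_derivative (\<lambda>h. hess f y *v h)) (at y)" by simp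
  then have "((\<lambda>t. grad f (x + t *\<^sub>R s)) has_derivative (\<lambda>h. hess f y *v (h *\<^sub>R s))) (at t)"
    unfolding y_def
    by (rule has_derivative_compose[rotated]) (auto intro!: derivative_eq_intros)
  then have "((\<lambda>t. v \<bullet> grad f (x + t *\<^sub>R s)) has_derivative (\<lambda>h. v \<bullet> (hess f y *v (h *\<^sub>R s)))) (at t)"
    by (rule has_derivative_inner_right)
  then show ?thesis
    by (simp add: has_field_derivative_def mult_commute_abs matrix_vector_mult_scaleR y_def)
qed

text \<open>Two points at distance 1 turn the Lipschitz inequality for \<open>hess f\<close> into a
  lower bound on \<open>L2\<close> by a norm.\<close>

lemma AS1_L2_nonneg:
  fixes f :: "real^'n \<Rightarrow> real"
  assumes "AS1 f L1 L2"
  shows "0 \<le> L2"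
proof -
  have "0 \<le> spectral_norm (hess f (axis undefined 1) - hess f 0)"
    unfolding spectral_norm_def by (rule onorm_pos_le) (rule matrix_vector_mul_bounded_linear)
  also have "\<dots> \<le> L2 * norm (axis undefined 1 - 0 :: real^'n)"
    using assms unfolding AS1_def by blast
  finally show ?thesis by (simp add: norm_axis_1)
qed

text \<open>The remainder \<open>v\<close> is tested against itself, which replaces an integral of
  vectors by monotonicity of a scalar function on [0, 1].\<close>

lemma grad_taylor:
  fixes f :: "real^'n \<Rightarrow> real"
  assumes "AS1 f L1 L2"
  shows "norm (grad f (x + s) - grad f x - hess f x *v s) \<le> L2/2 * (norm s)\<^sup>2"
proof -
  define v where "v = grad f (x + s) - grad f x - hess f x *v s"
  define \<phi> where "\<phi> = (\<lambda>t. v \<bullet> grad f (x + t *\<^sub>R s) - t * (v \<bullet> (hess f x *v s))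
                              - L2/2 * t\<^sup>2 * (norm s)\<^sup>2 * norm v)"
  have "\<phi> 1 \<le> \<phi> 0"
  proof (rule DERIV_nonpos_imp_nonincreasing[of 0 1 \<phi>])
    fix t :: real assume t: "0 \<le> t" "t \<le> 1"
    let ?y = "v \<bullet> (hess f (x + t *\<^sub>R s) *v s) - v \<bullet> (hess f x *v s) - L2 * t * (norm s)\<^sup>2 * norm v"
    have "(\<phi> has_real_derivative ?y) (at t)"
      unfolding \<phi>_def using assms
      by (auto intro!: derivative_eq_intros line_grad_has_derivative
               simp: AS1_def twice_cont_differentiable_def)
    moreover have "?y \<le> 0"
    proof -
      let ?A = "hess f (x + t *\<^sub>R s) - hess f x"
      have "v \<bullet> (?A *v s) \<le> norm v * norm (?A *v s)" by (rule norm_cauchy_schwarz)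
      also have "\<dots> \<le> norm v * (spectral_norm ?A * norm s)"
        by (intro mult_left_mono norm_matrix_vector_le) auto
      also have "spectral_norm ?A \<le> L2 * norm (x + t *\<^sub>R s - x)"
        using assms unfolding AS1_def by blast
      then have "norm v * (spectral_norm ?A * norm s) \<le> norm v * (L2 * norm (x + t *\<^sub>R s - x) * norm s)"
        by (intro mult_left_mono mult_right_mono) auto
      also have "\<dots> = L2 * t * (norm s)\<^sup>2 * norm v"
        using t by (simp add: power2_eq_square)
      finally show ?thesis
        by (simp add: matrix_vector_mult_diff_rdistrib inner_diff_right)
    qed
    ultimately show "\<exists>y. (\<phi> has_real_derivative y) (at t) \<and> y \<le> 0" by blast
  qed simp
  \<comment> \<open>With \<open>v\<close> the remainder itself, comparing \<open>\<phi>\<close> at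
    the endpoints bounds the square of \<open>norm v\<close> by a multiple of \<open>norm v\<close>,
    and one factor cancels.\<close>
  then have "v \<bullet> v \<le> L2/2 * (norm s)\<^sup>2 * norm v"
    unfolding \<phi>_def by (simp add: v_def[symmetric] inner_diff_right)
      (simp add: v_def inner_diff_right)
  then have "norm v * norm v \<le> (L2/2 * (norm s)\<^sup>2) * norm v"
    by (simp add: norm_eq_sqrt_inner)
  then have "norm v \<le> L2/2 * (norm s)\<^sup>2"
    using AS1_L2_nonneg[OF assms] by (cases "norm v = 0") (auto simp: mult_le_cancel_right)
  then show ?thesis by (simp add: v_def)
qed

text \<open>The same monotonicity argument one order higher: the derivative along the segment is
  controlled by \<open>grad_taylor\<close> for the step \<open>t *\<^sub>R s\<close>.\<close>

lemma function_taylor: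
  fixes f :: "real^'n \<Rightarrow> real"
  assumes "AS1 f L1 L2"
  shows "f (x + s) \<le> quad_model f x s + L2/6 * norm s ^ 3"
proof -
  define \<phi> where "\<phi> = (\<lambda>t. f (x + t *\<^sub>R s) - t * (s \<bullet> grad f x) - t\<^sup>2/2 * (s \<bullet> (hess f x *v s))
                              - L2/6 * t^3 * norm s ^ 3)"
  have "\<phi> 1 \<le> \<phi> 0"
  proof (rule DERIV_nonpos_imp_nonincreasing[of 0 1 \<phi>])
    fix t :: real assume t: "0 \<le> t" "t \<le> 1"
    let ?y = "s \<bullet> grad f (x + t *\<^sub>R s) - s \<bullet> grad f x - t * (s \<bullet> (hess f x *v s)) - L2/2 * t\<^sup>2 * norm s ^ 3"
    have "(\<phi> has_real_derivative ?y) (at t)"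
      unfolding \<phi>_def using assms
      by (auto intro!: derivative_eq_intros line_has_derivative
               simp: AS1_def twice_cont_differentiable_def)
    moreover have "?y \<le> 0"
    proof -
      let ?r = "grad f (x + t *\<^sub>R s) - grad f x - hess f x *v (t *\<^sub>R s)"
      have "s \<bullet> ?r \<le> norm s * norm ?r" by (rule norm_cauchy_schwarz)
      also have "\<dots> \<le> norm s * (L2/2 * (norm (t *\<^sub>R s))\<^sup>2)"
        by (intro mult_left_mono grad_taylor[OF assms]) auto
      also have "\<dots> = L2/2 * t\<^sup>2 * norm s ^ 3"
        by (simp add: power2_eq_square power3_eq_cube)
      finally show ?thesis by (simp add: inner_diff_right matrix_vector_mult_scaleR)
    qed
    ultimately show "\<exists>y. (\<phi> has_real_derivative y) (at t) \<and> y \<le> 0" by blast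
  qed simp
  then show ?thesis by (simp add: \<phi>_def quad_model_def)
qed

text \<open>The second difference of \<open>f\<close> is symmetric in \<open>u\<close> and \<open>v\<close>, hence so is its leading term.\<close>

lemma second_difference:
  fixes f :: "real^'n \<Rightarrow> real"
  assumes "AS1 f L1 L2"
  shows "\<bar>f (x + u + v) - f (x + u) - f (x + v) + f x - v \<bullet> (hess f x *v u)\<bar>
           \<le> L2 * (norm u + norm v) ^ 3"
proof -
  have diff: "\<And>y. f differentiable at y"
    using assms by (auto simp: AS1_def twice_cont_differentiable_def)
  \<comment> \<open>The mean value theorem for
    \<open>f (x + u + t *\<^sub>R v) - f (x + t *\<^sub>R v)\<close> as a function of
    \<open>t\<close> reduces the second difference to a difference of gradients at points
    \<open>u\<close> apart.\<close>
  have "\<exists>t. 0 < t \<and> t < 1 \<and>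
      (f (x + u + 1 *\<^sub>R v) - f (x + 1 *\<^sub>R v)) - (f (x + u + 0 *\<^sub>R v) - f (x + 0 *\<^sub>R v))
        = (1 - 0) * (v \<bullet> grad f (x + u + t *\<^sub>R v) - v \<bullet> grad f (x + t *\<^sub>R v))"
    by (rule MVT2) (auto intro!: derivative_intros line_has_derivative diff)
  then obtain t where t: "0 < t" "t < 1"
    and eq: "f (x + u + v) - f (x + u) - f (x + v) + f x
               = v \<bullet> (grad f (x + (u + t *\<^sub>R v)) - grad f (x + t *\<^sub>R v))"
    by (auto simp: inner_diff_right algebra_simps)
  define r where "r h = grad f (x + h) - grad f x - hess f x *v h" for h
  have N: "norm (t *\<^sub>R v) \<le> norm v" using t by (simp add: mult_left_le_one_le)
  have r: "norm (r h) \<le> L2/2 * (norm u + norm v)\<^sup>2" if "norm h \<le> norm u + norm v" for h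
  proof -
    have "norm (r h) \<le> L2/2 * (norm h)\<^sup>2" unfolding r_def by (rule grad_taylor[OF assms])
    also have "\<dots> \<le> L2/2 * (norm u + norm v)\<^sup>2"
      using that AS1_L2_nonneg[OF assms] by (intro mult_left_mono power_mono) auto
    finally show ?thesis .
  qed
  have "grad f (x + (u + t *\<^sub>R v)) - grad f (x + t *\<^sub>R v) - hess f x *v u = r (u + t *\<^sub>R v) - r (t *\<^sub>R v)"
    by (simp add: r_def matrix_vector_right_distrib)
  then have "\<bar>f (x + u + v) - f (x + u) - f (x + v) + f x - v \<bullet> (hess f x *v u)\<bar>
      = \<bar>v \<bullet> (r (u + t *\<^sub>R v) - r (t *\<^sub>R v))\<bar>"
    unfolding eq inner_diff_right[symmetric] by simp
  also have "\<dots> \<le> norm v * norm (r (u + t *\<^sub>R v) - r (t *\<^sub>R v))"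
    by (rule Cauchy_Schwarz_ineq2)
  also have "\<dots> \<le> norm v * (norm (r (u + t *\<^sub>R v)) + norm (r (t *\<^sub>R v)))"
    by (intro mult_left_mono norm_triangle_ineq4) auto
  also have "\<dots> \<le> (norm u + norm v) * (L2/2 * (norm u + norm v)\<^sup>2 + L2/2 * (norm u + norm v)\<^sup>2)"
    using N norm_triangle_ineq[of u "t *\<^sub>R v"]
    by (intro mult_mono add_mono r) (auto intro: order_trans)
  also have "\<dots> = L2 * (norm u + norm v) ^ 3"
    by (simp add: power2_eq_square power3_eq_cube)
  finally show ?thesis .
qed

text \<open>Scaling \<open>u\<close> and \<open>v\<close> by \<open>t\<close> makes the asymmetry
  quadratic in \<open>t\<close>, while the error of the second difference is cubic; small
  \<open>t\<close> forces the asymmetry to vanish.\<close>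

lemma hess_symmetric:
  fixes f :: "real^'n \<Rightarrow> real"
  assumes "AS1 f L1 L2"
  shows "u \<bullet> (hess f x *v v) = v \<bullet> (hess f x *v u)"
proof (rule ccontr)
  define d where "d = \<bar>u \<bullet> (hess f x *v v) - v \<bullet> (hess f x *v u)\<bar>"
  define C where "C = 2 * L2 * (norm u + norm v) ^ 3"
  assume "u \<bullet> (hess f x *v v) \<noteq> v \<bullet> (hess f x *v u)"
  then have "d > 0" by (simp add: d_def)
  have C: "C \<ge> 0" using AS1_L2_nonneg[OF assms] by (simp add: C_def)
  have le: "d \<le> C * t" if t: "t > 0" for t
  proof -
    let ?u = "t *\<^sub>R u" and ?v = "t *\<^sub>R v"
    have "\<bar>?u \<bullet> (hess f x *v ?v) - ?v \<bullet> (hess f x *v ?u)\<bar> \<le> 2 * L2 * (norm ?u + norm ?v) ^ 3"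
      using second_difference[OF assms, of x ?u ?v] second_difference[OF assms, of x ?v ?u]
      by (simp add: add.commute add.left_commute)
    moreover have "?u \<bullet> (hess f x *v ?v) - ?v \<bullet> (hess f x *v ?u)
        = t\<^sup>2 * (u \<bullet> (hess f x *v v) - v \<bullet> (hess f x *v u))"
      by (simp add: matrix_vector_mult_scaleR power2_eq_square algebra_simps)
    moreover have "norm ?u + norm ?v = t * (norm u + norm v)"
      using t by (simp add: algebra_simps)
    ultimately have "t\<^sup>2 * d \<le> 2 * L2 * (t * (norm u + norm v)) ^ 3"
      by (simp add: d_def abs_mult)
    then have "t\<^sup>2 * d \<le> t\<^sup>2 * (C * t)"
      by (simp add: C_def power_mult_distrib power2_eq_square power3_eq_cube ac_simps)
    then show ?thesis using t by simp
  qed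
  \<comment> \<open>A value of \<open>t\<close> small enough to contradict \<open>le\<close>; adding
    1 to \<open>C\<close> keeps the denominator positive.\<close>
  have "C * (d / (2 * (C + 1))) < d"
    using C \<open>d > 0\<close> by (simp add: field_simps add_strict_increasing)
  with le[of "d / (2 * (C + 1))"] C \<open>d > 0\<close> show False by simp
qed

text \<open>The norm is differentiated away from the origin, and symmetry of the Hessian merges the
  two halves of the derivative of the quadratic form.\<close>

lemma grad_cubic_model:
  fixes f :: "real^'n \<Rightarrow> real"
  assumes "AS1 f L1 L2" and "s \<noteq> 0"
  shows "grad (cubic_model f x \<sigma>) s = grad f x + hess f x *v s + (\<sigma> * norm s) *\<^sub>R s"
proof (rule grad_eqI)
  have H: "((\<lambda>s. hess f x *v s) has_derivative (\<lambda>h. hess f x *v h)) (at s)"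
    by (rule bounded_linear_imp_has_derivative) (rule matrix_vector_mul_bounded_linear)
  have "(cubic_model f x \<sigma> has_derivative
     (\<lambda>h. h \<bullet> grad f x + 1/2 * (s \<bullet> (hess f x *v h) + h \<bullet> (hess f x *v s))
           + 1/3 * \<sigma> * (3 * norm s ^ 2 * (h \<bullet> sgn s)))) (at s)"
    unfolding cubic_model_def[abs_def] quad_model_def[abs_def] using assms(2)
    by (auto intro!: derivative_eq_intros H has_derivative_norm)
  moreover have "norm s ^ 2 * (h \<bullet> sgn s) = norm s * (h \<bullet> s)" for h
    using assms(2) by (simp add: sgn_div_norm power2_eq_square field_simps)
  ultimately show "GDERIV (cubic_model f x \<sigma>) s :> grad f x + hess f x *v s + (\<sigma> * norm s) *\<^sub>R s"
    unfolding gderiv_def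
    by (simp add: hess_symmetric[OF assms(1), of s] inner_commute inner_add_right algebra_simps)
qed

section \<open>Subspace minimization and the regularized Newton equation\<close>

lemma norm_cols_mult:
  assumes "orthonormal_cols W" and "dim_vec v = length W"
  shows "norm (cols_mult W v) = euclid_norm v"
proof -
  have "cols_mult W v \<bullet> cols_mult W v
      = (\<Sum>i<length W. \<Sum>j<length W. vec_index v i * vec_index v j * (W ! i \<bullet> W ! j))"
    by (simp add: cols_mult_def inner_sum_left inner_sum_right sum_distrib_left mult.assoc)
      (simp add: inner_commute)
  also have "\<dots> = (\<Sum>i<length W. \<Sum>j<length W. if i = j then vec_index v i * vec_index v j else 0)"
    using assms(1) by (intro sum.cong refl) (auto simp: orthonormal_cols_def)
  also have "\<dots> = scalar_prod v v"
    using assms(2) by (simp add: scalar_prod_def atLeast0LessThan)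
  finally show ?thesis by (simp add: norm_eq_sqrt_inner euclid_norm_def)
qed

lemma scalar_prod_proj_vec:
  assumes "dim_vec v = length W"
  shows "scalar_prod v (proj_vec W g) = cols_mult W v \<bullet> g"
  using assms by (simp add: scalar_prod_def proj_vec_def cols_mult_def inner_sum_left atLeast0LessThan)

lemma proj_mat_mult_vec:
  assumes "dim_vec v = length W"
  shows "proj_mat W H *\<^sub>v v = proj_vec W (H *v cols_mult W v)"
proof (rule eq_vecI)
  fix i assume "i < dim_vec (proj_vec W (H *v cols_mult W v))"
  then have i: "i < length W" by (simp add: proj_vec_def)
  have "H *v cols_mult W v = (\<Sum>j<length W. vec_index v j *\<^sub>R (H *v W ! j))"
    unfolding cols_mult_def
    by (simp add: linear_sum[OF matrix_vector_mul_linear] matrix_vector_mult_scaleR)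
  then show "vec_index (proj_mat W H *\<^sub>v v) i = vec_index (proj_vec W (H *v cols_mult W v)) i"
    using i assms
    by (simp add: proj_mat_def proj_vec_def scalar_prod_def inner_sum_right atLeast0LessThan mult.commute)
qed (simp add: proj_mat_def proj_vec_def)

text \<open>Taking the inner product of the reduced system \<open>A s = - W\<^sup>T g\<close> with
  \<open>s\<close> and lifting it by \<open>W\<close> gives the identity for
  \<open>z \<bullet> g\<close>; positive definiteness of \<open>A\<close> gives the strict
  inequality.\<close>

lemma reduced_solution_properties:
  fixes g :: "real^'n"
  assumes W: "orthonormal_basis_of_range W (V @ [g])"
    and red: "reduced_solution g H \<sigma> W lam s"
    and g: "g \<noteq> 0"
  defines "z \<equiv> cols_mult W s"
  shows "norm z = euclid_norm s" and "z \<noteq> 0" and "lam = \<sigma> * norm z"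
    and "z \<bullet> g = - (z \<bullet> (H *v z) + lam * (norm z)\<^sup>2)"
    and "0 < z \<bullet> (H *v z) + lam * (norm z)\<^sup>2"
proof -
  define p where "p = length W"
  define A where "A = proj_mat W H + lam \<cdot>\<^sub>m 1\<^sub>m p"
  obtain B where pd: "positive_definite p A" and B: "B \<in> carrier_mat p p" "inverts_mat A B"
    and lam: "lam = \<sigma> * euclid_norm (B *\<^sub>v proj_vec W g)"
    and s: "s = - (B *\<^sub>v proj_vec W g)"
    using red unfolding reduced_solution_def Let_def A_def p_def by blast
  have A: "A \<in> carrier_mat p p" using pd by (simp add: positive_definite_def)
  have pg: "proj_vec W g \<in> carrier_vec p" by (simp add: proj_vec_def p_def)
  have Bg: "B *\<^sub>v proj_vec W g \<in> carrier_vec p" using B pg by auto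
  have sp: "s \<in> carrier_vec p" unfolding s using Bg by simp
  then have dim: "dim_vec s = length W" unfolding p_def by (rule carrier_vecD)
  have orth: "orthonormal_cols W" using W by (simp add: orthonormal_basis_of_range_def)
  show nz: "norm z = euclid_norm s" unfolding z_def by (rule norm_cols_mult[OF orth dim])
  have "euclid_norm s = euclid_norm (B *\<^sub>v proj_vec W g)"
    unfolding euclid_norm_def s by simp
  then show "lam = \<sigma> * norm z" using lam nz by simp
  have "A *\<^sub>v (B *\<^sub>v proj_vec W g) = proj_vec W g"
    using assoc_mult_mat_vec[OF A B(1) pg, symmetric] B(2) A pg by (simp add: inverts_mat_def)
  then have AB: "vec_index (A *\<^sub>v (B *\<^sub>v proj_vec W g)) i = vec_index (proj_vec W g) i" for i by simp
  have As: "A *\<^sub>v s = - proj_vec W g"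
    unfolding s
  proof (rule eq_vecI)
    fix i assume "i < dim_vec (- proj_vec W g)"
    then have "i < p" using pg by simp
    then show "vec_index (A *\<^sub>v - (B *\<^sub>v proj_vec W g)) i = vec_index (- proj_vec W g) i"
      using A B(1) pg AB[of i] by simp
  qed (use A pg in auto)
  have "scalar_prod s (A *\<^sub>v s) = - scalar_prod s (proj_vec W g)"
    unfolding As using sp pg by simp
  then have sA1: "scalar_prod s (A *\<^sub>v s) = - (z \<bullet> g)"
    using scalar_prod_proj_vec[OF dim] by (simp add: z_def)
  have "A *\<^sub>v s = proj_mat W H *\<^sub>v s + lam \<cdot>\<^sub>v s"
    unfolding A_def using sp
    by (subst add_mult_distrib_mat_vec[of _ p p]) (auto simp: proj_mat_def p_def)
  then have "scalar_prod s (A *\<^sub>v s) = scalar_prod s (proj_vec W (H *v z)) + lam * scalar_prod s s"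
    using sp by (simp add: proj_mat_mult_vec[OF dim] z_def scalar_prod_add_distrib[of _ p]
        proj_vec_def p_def)
  moreover have "scalar_prod s s = (norm z)\<^sup>2"
  proof -
    have "0 \<le> scalar_prod s s" by (simp add: scalar_prod_def sum_nonneg)
    then show ?thesis unfolding nz euclid_norm_def by simp
  qed
  ultimately have sA2: "scalar_prod s (A *\<^sub>v s) = z \<bullet> (H *v z) + lam * (norm z)\<^sup>2"
    using scalar_prod_proj_vec[OF dim] by (simp add: z_def)
  show "z \<bullet> g = - (z \<bullet> (H *v z) + lam * (norm z)\<^sup>2)" using sA1 sA2 by simp
  \<comment> \<open>A zero solution would make \<open>g\<close> orthogonal to every column of
    \<open>W\<close>, although \<open>g\<close> lies in their span.\<close>
  have "s \<noteq> 0\<^sub>v p"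
  proof
    assume "s = 0\<^sub>v p"
    then have "A *\<^sub>v s = 0\<^sub>v p" using A by (intro eq_vecI) auto
    with As have pz: "- proj_vec W g = 0\<^sub>v p" by simp
    have perp: "w \<bullet> g = 0" if "w \<in> set W" for w
    proof -
      from that obtain i where i: "i < length W" "w = W ! i" by (auto simp: in_set_conv_nth)
      then have "vec_index (- proj_vec W g) i = 0" unfolding pz by (simp add: p_def)
      with i show ?thesis by (simp add: proj_vec_def)
    qed
    have "y \<bullet> g = 0" if "y \<in> span (set W)" for y
      using that by (induction rule: span_induct) (auto simp: subspace_def inner_add_left perp)
    moreover have "g \<in> span (set W)"
      using W by (auto simp: orthonormal_basis_of_range_def intro: span_base)
    ultimately have "g \<bullet> g = 0" by blast
    with g show False by simp
  qed
  then show pos: "0 < z \<bullet> (H *v z) + lam * (norm z)\<^sup>2"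
    using pd sp sA2 by (auto simp: positive_definite_def)
  then show "z \<noteq> 0" by auto
qed

text \<open>Every way out of the loop returns a pair computed from the very \<open>W\<close> that is
  returned. The columns \<open>U\<close> stay unspecified; what matters later is that the gradient
  lies in the range of \<open>W\<close>.\<close>

lemma refresh_loop_output:
  assumes "refresh_loop P f x \<sigma> j V lam s W V'"
  shows "\<exists>U. orthonormal_basis_of_range W (U @ [grad f x]) \<and>
             reduced_solution (grad f x) (hess f x) \<sigma> W lam s"
  using assms by induction blast+

lemma subspace_min_output:
  assumes "subspace_min P f S lam s W V'"
  shows "\<exists>U. orthonormal_basis_of_range W (U @ [grad f (iterate S)]) \<and>
             reduced_solution (grad f (iterate S)) (hess f (iterate S)) (sigma S) W lam s"
  using assms refresh_loop_output[of P f "iterate S" "sigma S" 1 "[]" lam s W V']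
  by (auto simp: subspace_min_def split: if_splits)

lemma matrix_mul_matrix_inv:
  fixes A :: "real^'n^'n"
  assumes "invertible A"
  shows "A ** matrix_inv A = Finite_Cartesian_Product.mat 1"
  unfolding matrix_inv_def by (rule someI2_ex) (use assms in \<open>auto simp: invertible_def\<close>)

lemma newton_step_equation:
  fixes H :: "real^'n^'n"
  assumes "newton_step H g lam s"
  shows "g + H *v s = - (lam *\<^sub>R s)"
proof -
  have inv: "shifted H lam ** matrix_inv (shifted H lam) = Finite_Cartesian_Product.mat 1"
    and s: "s = - (matrix_inv (shifted H lam) *v g)"
    using assms matrix_mul_matrix_inv by (auto simp: newton_step_def)
  have "shifted H lam *v s = - g"
    unfolding s using inv
    by (simp add: linear_neg[OF matrix_vector_mul_linear] matrix_vector_mul_assoc)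
  then have "H *v s + lam *\<^sub>R s = - g"
    by (simp add: matrix_vector_mult_add_rdistrib scaleR_matrix_vector_assoc[symmetric])
  then show ?thesis by (simp add: eq_neg_iff_add_eq_0 add.commute add.left_commute)
qed

section \<open>Model decrease and residual of a tested step\<close>

text \<open>The smallest of the factors guaranteed by the three kinds of step: 1/2 for a subspace
  step, \<open>1 / (2 * C_up P)\<close> for an accepted Newton step, 1/3 for a recomputed
  one.\<close>

definition decrease_const :: "far2_params \<Rightarrow> real" where
  "decrease_const P = min (1/3) (1 / (2 * C_up P))"

text \<open>One constant for all kinds of step: the first two terms serve steps with small model
  gradient, the last serves accepted Newton steps. It increases with \<open>\<sigma>\<close>, so it
  can be evaluated at \<open>sigma_max\<close>.\<close>

definition residual_const :: "far2_params \<Rightarrow> real \<Rightarrow> real" where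
  "residual_const P \<sigma> = theta1 P / 2 + \<sigma> + \<sigma> / C_low P"

text \<open>The decrease equals \<open>lam / 2 * (norm s)\<^sup>2\<close> plus half of the positive
  quantity in the second assumption.\<close>

lemma quad_model_decrease:
  fixes f :: "real^'n \<Rightarrow> real"
  assumes "s \<bullet> grad f x = - (s \<bullet> (hess f x *v s) + lam * (norm s)\<^sup>2)"
    and "0 < s \<bullet> (hess f x *v s) + lam * (norm s)\<^sup>2"
  shows "lam / 2 * (norm s)\<^sup>2 \<le> quad_model f x 0 - quad_model f x s"
  using assms by (simp add: quad_model_def)

text \<open>The model gradient is the residual plus the cubic term's gradient, whose norm is
  \<open>sigma S * (norm s)\<^sup>2\<close>.\<close>

lemma residual_of_small_model_gradient:
  fixes f :: "real^'n \<Rightarrow> real"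
  assumes "AS1 f L1 L2" and "valid_params TYPE('n) P" and "0 < sigma S" and "s \<noteq> 0"
    and "small_model_gradient P f S s"
  shows "norm (grad f (iterate S) + hess f (iterate S) *v s) \<le> residual_const P (sigma S) * (norm s)\<^sup>2"
proof -
  let ?r = "grad f (iterate S) + hess f (iterate S) *v s"
  have "norm ?r \<le> norm (?r + (sigma S * norm s) *\<^sub>R s) + norm ((sigma S * norm s) *\<^sub>R s)"
    using norm_triangle_ineq4[of "?r + (sigma S * norm s) *\<^sub>R s" "(sigma S * norm s) *\<^sub>R s"] by simp
  also have "\<dots> \<le> 1/2 * theta1 P * (norm s)\<^sup>2 + sigma S * (norm s)\<^sup>2"
    using assms by (intro add_mono)
      (auto simp: small_model_gradient_def grad_cubic_model power2_eq_square)
  also have "\<dots> \<le> residual_const P (sigma S) * (norm s)\<^sup>2"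
    using assms by (simp add: residual_const_def distrib_right valid_params_def)
  finally show ?thesis .
qed

text \<open>For subspace and Newton steps the decrease comes from
  \<open>quad_model_decrease\<close>, with the shift comparable to \<open>sigma S * norm s\<close>;
  for a recomputed step it comes from the decrease of the cubic model.\<close>

lemma compute_step_properties:
  fixes f :: "real^'n \<Rightarrow> real"
  assumes AS1: "AS1 f L1 L2" and P: "valid_params TYPE('n) P"
    and \<sigma>: "0 < sigma S" and g: "grad f (iterate S) \<noteq> 0"
    and step: "compute_step P f S (Some s) V'"
  shows "s \<noteq> 0 \<and>
    decrease_const P * sigma S * norm s ^ 3
      \<le> quad_model f (iterate S) 0 - quad_model f (iterate S) s \<and>
    norm (grad f (iterate S) + hess f (iterate S) *v s) \<le> residual_const P (sigma S) * (norm s)\<^sup>2"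
proof -
  let ?x = "iterate S" and ?\<sigma> = "sigma S"
  have C: "0 < C_low P" "0 < C_up P" and \<theta>: "0 < theta1 P"
    using P by (auto simp: valid_params_def)
  have dc: "decrease_const P * ?\<sigma> * norm s ^ 3 \<le> c * ?\<sigma> * norm s ^ 3"
    if "decrease_const P \<le> c" for c
    using that \<sigma> by (intro mult_right_mono) auto
  from step show ?thesis
  proof cases
    case (subspace_accepted lamh sh W)
    obtain U where "orthonormal_basis_of_range W (U @ [grad f ?x])"
        "reduced_solution (grad f ?x) (hess f ?x) ?\<sigma> W lamh sh"
      using subspace_min_output subspace_accepted by blast
    note z = reduced_solution_properties[OF this g, folded subspace_accepted(1)]
    have "decrease_const P * ?\<sigma> * norm s ^ 3 \<le> 1/2 * ?\<sigma> * norm s ^ 3"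
      by (rule dc) (simp add: decrease_const_def min_def)
    also have "\<dots> = lamh / 2 * (norm s)\<^sup>2"
      using z(3) by (simp add: power2_eq_square power3_eq_cube)
    also have "\<dots> \<le> quad_model f ?x 0 - quad_model f ?x s"
      by (rule quad_model_decrease) (use z in auto)
    finally show ?thesis
      using residual_of_small_model_gradient[OF AS1 P \<sigma> z(2)] subspace_accepted z(2) by simp
  next
    case (newton_accepted lamh sh W)
    obtain U where "orthonormal_basis_of_range W (U @ [grad f ?x])"
        "reduced_solution (grad f ?x) (hess f ?x) ?\<sigma> W lamh sh"
      using subspace_min_output newton_accepted by blast
    note z = reduced_solution_properties[OF this g]
    define h where "h = euclid_norm sh"
    have h: "0 < h" "lamh = ?\<sigma> * h" using z(1,2,3) unfolding h_def by (auto simp flip: z(1))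
    \<comment> \<open>Passing the tests makes \<open>norm s\<close> comparable to \<open>h\<close>:
      the upper bound will serve the decrease, the lower bound the residual.\<close>
    have acc: "0 < s \<bullet> (shifted (hess f ?x) lamh *v s)" "C_low P * h \<le> norm s" "norm s \<le> C_up P * h"
      using newton_accepted(4) h(1) unfolding newton_rejected_def h_def[symmetric]
      by (auto simp: field_simps)
    have eq: "grad f ?x + hess f ?x *v s = - (lamh *\<^sub>R s)"
      by (rule newton_step_equation) fact
    have "s \<bullet> (shifted (hess f ?x) lamh *v s) = s \<bullet> (hess f ?x *v s) + lamh * (norm s)\<^sup>2"
      by (simp add: matrix_vector_mult_add_rdistrib scaleR_matrix_vector_assoc[symmetric]
          inner_add_right power2_norm_eq_inner)
    with acc(1) have pos: "0 < s \<bullet> (hess f ?x *v s) + lamh * (norm s)\<^sup>2" by simp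
    have "s \<bullet> (grad f ?x + hess f ?x *v s) = - (lamh * (norm s)\<^sup>2)"
      unfolding eq by (simp add: power2_norm_eq_inner)
    then have sg: "s \<bullet> grad f ?x = - (s \<bullet> (hess f ?x *v s) + lamh * (norm s)\<^sup>2)"
      by (simp add: inner_add_right)
    have "s \<noteq> 0" using pos by auto
    have "decrease_const P * ?\<sigma> * norm s ^ 3 \<le> 1 / (2 * C_up P) * ?\<sigma> * norm s ^ 3"
      by (rule dc) (simp add: decrease_const_def)
    also have "\<dots> = ?\<sigma> * (norm s / C_up P) / 2 * (norm s)\<^sup>2"
      using C by (simp add: power2_eq_square power3_eq_cube)
    also have "\<dots> \<le> ?\<sigma> * h / 2 * (norm s)\<^sup>2"
      using acc(3) C \<sigma> by (intro mult_right_mono divide_right_mono mult_left_mono)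
        (auto simp: field_simps)
    also have "\<dots> \<le> quad_model f ?x 0 - quad_model f ?x s"
      using quad_model_decrease[OF sg pos] h(2) by simp
    finally have 1: "decrease_const P * ?\<sigma> * norm s ^ 3 \<le> quad_model f ?x 0 - quad_model f ?x s" .
    have "norm (grad f ?x + hess f ?x *v s) = ?\<sigma> * h * norm s"
      unfolding eq using h \<sigma> by simp
    also have "\<dots> \<le> ?\<sigma> * (norm s / C_low P) * norm s"
      using acc(2) C \<sigma> by (intro mult_right_mono mult_left_mono) (auto simp: field_simps)
    also have "\<dots> = ?\<sigma> / C_low P * (norm s)\<^sup>2" by (simp add: power2_eq_square)
    also have "\<dots> \<le> residual_const P ?\<sigma> * (norm s)\<^sup>2"
      using \<sigma> \<theta> by (intro mult_right_mono) (auto simp: residual_const_def)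
    finally show ?thesis using 1 \<open>s \<noteq> 0\<close> by simp
  next
    case (recomputed lamh sh W s' lam)
    \<comment> \<open>The strict decrease of the cubic model excludes the zero step.\<close>
    have "s \<noteq> 0" using recomputed by auto
    have "decrease_const P * ?\<sigma> * norm s ^ 3 \<le> 1/3 * ?\<sigma> * norm s ^ 3"
      by (rule dc) (simp add: decrease_const_def)
    also have "\<dots> \<le> quad_model f ?x 0 - quad_model f ?x s"
      using recomputed by (simp add: cubic_model_def)
    finally show ?thesis
      using residual_of_small_model_gradient[OF AS1 P \<sigma> \<open>s \<noteq> 0\<close>] recomputed \<open>s \<noteq> 0\<close> by simp
  qed
qed

section \<open>Effect of a single iteration on \<open>f\<close> and \<open>sigma\<close>\<close>

text \<open>The factor of \<open>norm (grad f (x + s)) powr (3/2)\<close> in the decrease of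
  \<open>f\<close> at a successful step. The base in the denominator is the constant
  \<open>K\<close> with \<open>norm (grad f (x + s)) \<le> K * (norm s)\<^sup>2\<close>.\<close>

definition sufficient_decrease :: "far2_params \<Rightarrow> real \<Rightarrow> real" where
  "sufficient_decrease P L2 = eta1 P * decrease_const P * sigma_min P
     / (L2 / 2 + residual_const P (sigma_max P L2)) powr (3/2)"

lemma decrease_const_pos: "valid_params TYPE('n::finite) P \<Longrightarrow> 0 < decrease_const P"
  by (auto simp: valid_params_def decrease_const_def)

lemma sigma_max_ge_sigma0: "sigma0 P \<le> sigma_max P L2"
  by (simp add: sigma_max_def)

lemma gradient_const_pos:
  assumes "valid_params TYPE('n::finite) P" and "0 \<le> L2"
  shows "0 < L2 / 2 + residual_const P (sigma_max P L2)"
proof -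
  have "0 < sigma_max P L2"
    using sigma_max_ge_sigma0[of P L2] assms by (auto simp: valid_params_def)
  then have "0 < residual_const P (sigma_max P L2)"
    using assms by (auto simp: valid_params_def residual_const_def intro!: add_pos_pos)
  then show ?thesis using assms(2) by simp
qed

lemma sufficient_decrease_pos:
  assumes "valid_params TYPE('n::finite) P" and "0 \<le> L2"
  shows "0 < sufficient_decrease P L2"
  using gradient_const_pos[OF assms] decrease_const_pos[OF assms(1)] assms(1)
  by (auto simp: sufficient_decrease_def valid_params_def intro!: divide_pos_pos)

text \<open>Condenses an iteration to what the counting needs. The delicate case is an unsuccessful
  test: failure of the ratio test bounds \<open>sigma S\<close> above, so that even after
  multiplication by \<open>gamma2 P\<close> it stays below \<open>sigma_max\<close>.\<close>

lemma far2_iteration_cases: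
  fixes f :: "real^'n \<Rightarrow> real"
  assumes AS1: "AS1 f L1 L2" and P: "valid_params TYPE('n) P"
    and g: "grad f (iterate S) \<noteq> 0"
    and \<sigma>: "sigma_min P \<le> sigma S" "sigma S \<le> sigma_max P L2"
    and it: "far2_iteration P f S b S'"
  obtains
    (abandoned) "\<not> b" "\<not> refresh S" "refresh S'" "iterate S' = iterate S" "sigma S' = sigma S"
  | (successful) "b" "\<not> refresh S'" "sigma_min P \<le> sigma S'" "sigma S' \<le> sigma_max P L2"
      "gamma1 P * sigma S \<le> sigma S'"
      "f (iterate S') + sufficient_decrease P L2 * norm (grad f (iterate S')) powr (3/2)
         \<le> f (iterate S)"
  | (unsuccessful) "\<not> b" "\<not> refresh S'" "sigma_min P \<le> sigma S'" "sigma S' \<le> sigma_max P L2"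
      "iterate S' = iterate S" "sigma S' = gamma2 P * sigma S"
  using it
proof cases
  case (abandoned_iteration V')
  moreover from abandoned_iteration have "\<not> refresh S" by (auto elim: compute_step.cases)
  ultimately show ?thesis by (intro abandoned) auto
next
  case (tested_iteration s V' \<sigma>')
  define x where "x = iterate S"
  define \<Delta> where "\<Delta> = quad_model f x 0 - quad_model f x s"
  define c where "c = decrease_const P"
  define K where "K = L2 / 2 + residual_const P (sigma_max P L2)"
  have \<sigma>0: "0 < sigma S" and smin: "0 < sigma_min P"
    using \<sigma>(1) P by (auto simp: valid_params_def)
  have cpos: "0 < c" using decrease_const_pos[OF P] by (simp add: c_def)
  have L2: "0 \<le> L2" by (rule AS1_L2_nonneg[OF AS1])
  have Kpos: "0 < K" unfolding K_def by (rule gradient_const_pos[OF P L2])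
  have s0: "s \<noteq> 0" and dec: "c * sigma S * norm s ^ 3 \<le> \<Delta>"
    and res: "norm (grad f x + hess f x *v s) \<le> residual_const P (sigma S) * (norm s)\<^sup>2"
    using compute_step_properties[OF AS1 P \<sigma>0 g tested_iteration(2)]
    by (auto simp: x_def \<Delta>_def c_def)
  have \<Delta>: "0 < \<Delta>"
    using dec cpos \<sigma>0 s0 by (intro less_le_trans[OF _ dec]) simp
  have \<eta>: "0 < eta1 P" "eta1 P < 1" "eta1 P \<le> eta2 P"
    and \<gamma>: "0 < gamma1 P" "gamma1 P < 1" "1 < gamma2 P" and C: "0 < C_up P" "0 < C_low P"
    using P by (auto simp: valid_params_def)
  have rho: "rho f x s = (f x - f (x + s)) / \<Delta>" by (simp add: rho_def \<Delta>_def)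
  have b: "b \<longleftrightarrow> eta1 P \<le> rho f x s" using tested_iteration by (simp add: x_def)
  have upd: "sigma_update P (rho f x s) (sigma S) \<sigma>'" using tested_iteration by (simp add: x_def)
  have S': "iterate S' = (if b then x + s else x)" "sigma S' = \<sigma>'" "\<not> refresh S'"
    using tested_iteration by (auto simp: x_def)
  show ?thesis
  proof (cases b)
    case True
    have sig: "sigma_min P \<le> \<sigma>'" "\<sigma>' \<le> sigma S" "gamma1 P * sigma S \<le> \<sigma>'"
      using upd True \<sigma> \<sigma>0 \<gamma> unfolding b sigma_update_def
      by (auto split: if_splits intro: mult_left_le_one_le)
    have fdec: "eta1 P * \<Delta> \<le> f x - f (x + s)"
      using True \<Delta> unfolding b rho by (simp add: field_simps)
    have rmono: "residual_const P (sigma S) \<le> residual_const P (sigma_max P L2)"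
      using \<sigma> C unfolding residual_const_def by (intro add_mono divide_right_mono) auto
    \<comment> \<open>The new gradient is the Taylor remainder plus the residual of the quadratic
      model, both of order \<open>(norm s)\<^sup>2\<close>.\<close>
    have "norm (grad f (x + s)) \<le> norm (grad f (x + s) - grad f x - hess f x *v s)
                                    + norm (grad f x + hess f x *v s)"
      using norm_triangle_ineq[of "grad f (x + s) - grad f x - hess f x *v s" "grad f x + hess f x *v s"]
      by simp
    also have "\<dots> \<le> L2 / 2 * (norm s)\<^sup>2 + residual_const P (sigma_max P L2) * (norm s)\<^sup>2"
      using res rmono by (intro add_mono grad_taylor[OF AS1])
        (meson mult_right_mono order_trans zero_le_power2)
    also have "\<dots> = K * (norm s)\<^sup>2" by (simp add: K_def distrib_right)
    finally have "norm (grad f (x + s)) powr (3/2) \<le> (K * (norm s)\<^sup>2) powr (3/2)"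
      by (intro powr_mono2) auto
    also have "\<dots> = K powr (3/2) * norm s ^ 3"
    proof -
      have "(norm s)\<^sup>2 powr (3/2) = norm s ^ 3"
        using s0 by (simp add: powr_powr flip: powr_numeral)
      then show ?thesis using Kpos by (simp add: powr_mult)
    qed
    finally have "sufficient_decrease P L2 * norm (grad f (x + s)) powr (3/2)
        \<le> sufficient_decrease P L2 * (K powr (3/2) * norm s ^ 3)"
      using sufficient_decrease_pos[OF P L2] by (intro mult_left_mono) auto
    also have "\<dots> = eta1 P * (c * sigma_min P * norm s ^ 3)"
      using Kpos by (simp add: sufficient_decrease_def K_def[symmetric] c_def)
    also have "\<dots> \<le> eta1 P * (c * sigma S * norm s ^ 3)"
      using \<eta> \<sigma> cpos by (intro mult_left_mono mult_right_mono) auto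
    also have "\<dots> \<le> eta1 P * \<Delta>" using dec \<eta> by (intro mult_left_mono) auto
    also note fdec
    finally show ?thesis
      using True S' sig \<sigma> by (intro successful) (auto simp: x_def)
  next
    case False
    then have r: "rho f x s < eta1 P" by (simp add: b)
    then have sig: "\<sigma>' = gamma2 P * sigma S"
      using upd \<eta> by (auto simp: sigma_update_def)
    have "f x - f (x + s) < eta1 P * \<Delta>"
      using r \<Delta> unfolding rho by (simp add: field_simps)
    moreover have "f (x + s) \<le> quad_model f x s + L2/6 * norm s ^ 3"
      by (rule function_taylor[OF AS1])
    moreover have "quad_model f x 0 = f x" by (simp add: quad_model_def)
    ultimately have "(1 - eta1 P) * \<Delta> < L2/6 * norm s ^ 3"
      by (simp add: \<Delta>_def algebra_simps)
    then have "(1 - eta1 P) * (c * sigma S * norm s ^ 3) < L2/6 * norm s ^ 3"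
      using mult_left_mono[OF dec, of "1 - eta1 P"] \<eta> by linarith
    then have "((1 - eta1 P) * c * sigma S) * norm s ^ 3 < L2/6 * norm s ^ 3"
      by (simp add: mult.assoc)
    then have lt: "(1 - eta1 P) * c * sigma S < L2/6"
      using s0 by (simp add: mult_less_cancel_right)
    \<comment> \<open>The two possible values of the minimum \<open>c\<close> produce exactly the
      two \<open>L2\<close> terms of \<open>sigma_max\<close>, up to the factor
      \<open>gamma2 P\<close>.\<close>
    have "sigma S < L2 * C_up P / (3 * (1 - eta1 P)) \<or> sigma S < L2 / (2 * (1 - eta1 P))"
    proof (cases "c = 1/3")
      case True
      then show ?thesis using lt[unfolded True] \<eta> by (simp add: field_simps)
    next
      case False
      then have c: "c = 1 / (2 * C_up P)" by (auto simp: c_def decrease_const_def min_def split: if_splits)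
      show ?thesis using lt[unfolded c] \<eta> C by (simp add: field_simps)
    qed
    then have "gamma2 P * sigma S \<le> sigma_max P L2"
    proof
      assume "sigma S < L2 * C_up P / (3 * (1 - eta1 P))"
      then have "gamma2 P * sigma S \<le> gamma2 P * (L2 * C_up P / (3 * (1 - eta1 P)))"
        using \<gamma> by (intro mult_left_mono) auto
      also have "\<dots> \<le> sigma_max P L2" unfolding sigma_max_def by (rule Max_ge) auto
      finally show ?thesis .
    next
      assume "sigma S < L2 / (2 * (1 - eta1 P))"
      then have "gamma2 P * sigma S \<le> gamma2 P * (L2 / (2 * (1 - eta1 P)))"
        using \<gamma> by (intro mult_left_mono) auto
      also have "\<dots> \<le> sigma_max P L2" unfolding sigma_max_def by (rule Max_ge) auto
      finally show ?thesis .
    qed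
    moreover have "sigma_min P \<le> gamma2 P * sigma S"
      using \<gamma> \<sigma>(1) \<sigma>0 mult_right_mono[of 1 "gamma2 P" "sigma S"] by linarith
    ultimately show ?thesis
      using False S' sig by (intro unsuccessful) (auto simp: x_def)
  qed
qed

section \<open>Counting iterations along a run\<close>

text \<open>Here \<open>u\<close> counts unsuccessful tested iterations. Each tested iteration earns
  two units, one for itself and one held in reserve while \<open>refresh\<close> is off; an
  abandoned iteration spends the reserve. The final decrease estimate is conditional because the
  latest successful step may reach a gradient of norm at most \<open>\<epsilon>\<close>.\<close>

lemma far2_run_invariants:
  fixes f :: "real^'n \<Rightarrow> real"
  assumes AS1: "AS1 f L1 L2" and P: "valid_params TYPE('n) P"
    and \<epsilon>: "0 < \<epsilon>" and run: "far2_run P f x0 \<epsilon> S succ"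
    and active: "\<forall>i<k. \<not> norm (grad f (iterate (S i))) \<le> \<epsilon>"
  shows "sigma_min P \<le> sigma (S k) \<and> sigma (S k) \<le> sigma_max P L2 \<and>
    (\<exists>u. sigma0 P * gamma1 P ^ card {i. i < k \<and> succ i} * gamma2 P ^ u \<le> sigma (S k) \<and>
         k + (if refresh (S k) then 0 else 1) \<le> 2 * (card {i. i < k \<and> succ i} + u)) \<and>
    f (iterate (S k)) \<le> f x0 \<and>
    (\<not> norm (grad f (iterate (S k))) \<le> \<epsilon> \<longrightarrow>
      f (iterate (S k)) + sufficient_decrease P L2 * \<epsilon> powr (3/2) * card {i. i < k \<and> succ i} \<le> f x0)"
  using active
proof (induction k)
  case 0
  have "S 0 = \<lparr>iterate = x0, sigma = sigma0 P, refresh = True, basis = []\<rparr>"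
    using run by (simp add: far2_run_def)
  then show ?case using P sigma_max_ge_sigma0[of P L2]
    by (auto simp: valid_params_def intro!: exI[of _ "0::nat"])
next
  case (Suc k)
  define \<kappa> where "\<kappa> = sufficient_decrease P L2"
  define n where "n = card {i. i < k \<and> succ i}"
  have \<kappa>: "0 < \<kappa>" unfolding \<kappa>_def by (rule sufficient_decrease_pos[OF P AS1_L2_nonneg[OF AS1]])
  have gk: "\<not> norm (grad f (iterate (S k))) \<le> \<epsilon>" using Suc.prems by simp
  then have g0: "grad f (iterate (S k)) \<noteq> 0" using \<epsilon> by auto
  from Suc obtain u where \<sigma>: "sigma_min P \<le> sigma (S k)" "sigma (S k) \<le> sigma_max P L2"
    and u: "sigma0 P * gamma1 P ^ n * gamma2 P ^ u \<le> sigma (S k)"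
      "k + (if refresh (S k) then 0 else 1) \<le> 2 * (n + u)"
    and f: "f (iterate (S k)) \<le> f x0" "f (iterate (S k)) + \<kappa> * \<epsilon> powr (3/2) * n \<le> f x0"
    using gk unfolding n_def[symmetric] \<kappa>_def[symmetric] by auto
  have it: "far2_iteration P f (S k) (succ k) (S (Suc k))"
    using run Suc.prems by (auto simp: far2_run_def less_Suc_eq_le)
  have "{i. i < Suc k \<and> succ i} = (if succ k then insert k {i. i < k \<and> succ i} else {i. i < k \<and> succ i})"
    by (auto simp: less_Suc_eq)
  then have card: "card {i. i < Suc k \<and> succ i} = (if succ k then Suc n else n)"
    by (simp add: n_def)
  have \<gamma>: "0 < gamma1 P" "1 < gamma2 P" using P by (auto simp: valid_params_def)
  from AS1 P g0 \<sigma> it show ?case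
  proof (cases rule: far2_iteration_cases)
    case abandoned
    \<comment> \<open>\<open>refresh\<close> is off before and on afterwards, so the left side of
      the counting inequality is unchanged and the same \<open>u\<close> serves.\<close>
    then show ?thesis using \<sigma> u f unfolding card \<kappa>_def[symmetric]
      by (auto intro!: exI[of _ u])
  next
    case successful
    have "sigma0 P * gamma1 P ^ Suc n * gamma2 P ^ u = gamma1 P * (sigma0 P * gamma1 P ^ n * gamma2 P ^ u)"
      by simp
    also have "\<dots> \<le> gamma1 P * sigma (S k)" using u(1) \<gamma> by (intro mult_left_mono) auto
    also have "\<dots> \<le> sigma (S (Suc k))" by (rule successful)
    finally have 1: "sigma0 P * gamma1 P ^ Suc n * gamma2 P ^ u \<le> sigma (S (Suc k))" .
    have dec: "f (iterate (S (Suc k))) + \<kappa> * norm (grad f (iterate (S (Suc k)))) powr (3/2)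
        \<le> f (iterate (S k))"
      using successful by (simp add: \<kappa>_def)
    have 2: "f (iterate (S (Suc k))) \<le> f x0"
    proof -
      have "0 \<le> \<kappa> * norm (grad f (iterate (S (Suc k)))) powr (3/2)" using \<kappa> by simp
      with dec f(1) show ?thesis by linarith
    qed
    have 3: "f (iterate (S (Suc k))) + \<kappa> * \<epsilon> powr (3/2) * Suc n \<le> f x0"
      if "\<not> norm (grad f (iterate (S (Suc k)))) \<le> \<epsilon>"
    proof -
      have "\<kappa> * \<epsilon> powr (3/2) \<le> \<kappa> * norm (grad f (iterate (S (Suc k)))) powr (3/2)"
        using that \<kappa> \<epsilon> by (intro mult_left_mono powr_mono2) auto
      with dec f(2) show ?thesis by (simp add: distrib_left)
    qed
    show ?thesis using successful u(2) 1 2 3 unfolding card \<kappa>_def[symmetric]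
      by (auto intro!: exI[of _ u])
  next
    case unsuccessful
    have "sigma0 P * gamma1 P ^ n * gamma2 P ^ Suc u = gamma2 P * (sigma0 P * gamma1 P ^ n * gamma2 P ^ u)"
      by simp
    also have "\<dots> \<le> sigma (S (Suc k))"
      unfolding unsuccessful(6) using u(1) \<gamma> by (intro mult_left_mono) auto
    finally show ?thesis using unsuccessful u(2) f unfolding card \<kappa>_def[symmetric]
      by (auto intro!: exI[of _ "Suc u"])
  qed
qed

text \<open>The total decrease of \<open>f\<close> limits the successful iterations; taking
  logarithms of the bounds on \<open>sigma\<close> then limits \<open>u\<close>, and the factor 2
  accounts for abandoned iterations.\<close>

lemma far2_run_bounds:
  fixes f :: "real^'n \<Rightarrow> real"
  assumes AS1: "AS1 f L1 L2" and AS2: "AS2 f f_low" and P: "valid_params TYPE('n) P"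
    and \<epsilon>: "0 < \<epsilon>" and run: "far2_run P f x0 \<epsilon> S succ"
    and active: "\<forall>i<k. \<not> norm (grad f (iterate (S i))) \<le> \<epsilon>"
  shows "real (card {i. i < k \<and> succ i})
           \<le> (f x0 - f_low) / sufficient_decrease P L2 * \<epsilon> powr (-3/2) + 1" (is ?A)
    and "real k \<le> 2 * (1 + \<bar>ln (gamma1 P)\<bar> / ln (gamma2 P)) * card {i. i < k \<and> succ i}
           + 2 * (ln (sigma_max P L2 / sigma0 P) / ln (gamma2 P))" (is ?B)
proof -
  define \<kappa> where "\<kappa> = sufficient_decrease P L2"
  have \<kappa>: "0 < \<kappa>" unfolding \<kappa>_def by (rule sufficient_decrease_pos[OF P AS1_L2_nonneg[OF AS1]])
  have low: "f_low \<le> f x" for x using AS2 by (simp add: AS2_def)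
  show ?A
  proof (cases k)
    case 0
    then show ?thesis using low[of x0] \<kappa> by (simp add: \<kappa>_def)
  next
    case (Suc m)
    \<comment> \<open>The decrease estimate is applied at \<open>m\<close>, where the gradient is
      still large; iteration \<open>m\<close> itself accounts for the additional 1.\<close>
    have "{i. i < k \<and> succ i} \<subseteq> insert m {i. i < m \<and> succ i}" using Suc by auto
    then have "card {i. i < k \<and> succ i} \<le> card (insert m {i. i < m \<and> succ i})"
      by (intro card_mono) auto
    also have "\<dots> \<le> card {i. i < m \<and> succ i} + 1" by (simp add: card_insert_if)
    finally have 1: "real (card {i. i < k \<and> succ i}) \<le> real (card {i. i < m \<and> succ i}) + 1" by linarith
    have "f (iterate (S m)) + \<kappa> * \<epsilon> powr (3/2) * card {i. i < m \<and> succ i} \<le> f x0"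
      using far2_run_invariants[OF AS1 P \<epsilon> run, of m] active Suc by (auto simp: \<kappa>_def)
    with low[of "iterate (S m)"] have "\<kappa> * \<epsilon> powr (3/2) * card {i. i < m \<and> succ i} \<le> f x0 - f_low"
      by linarith
    then have "card {i. i < m \<and> succ i} \<le> (f x0 - f_low) / (\<kappa> * \<epsilon> powr (3/2))"
      using \<kappa> \<epsilon> by (simp add: field_simps)
    also have "\<dots> = (f x0 - f_low) / \<kappa> * \<epsilon> powr (-3/2)"
      using powr_minus_divide[of \<epsilon> "3/2"] by simp
    finally show ?thesis using 1 by (simp add: \<kappa>_def)
  qed
  define n where "n = card {i. i < k \<and> succ i}"
  obtain u where "sigma (S k) \<le> sigma_max P L2"
      "sigma0 P * gamma1 P ^ n * gamma2 P ^ u \<le> sigma (S k)"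
      "k + (if refresh (S k) then 0 else 1) \<le> 2 * (n + u)"
    using far2_run_invariants[OF AS1 P \<epsilon> run active] unfolding n_def[symmetric] by blast
  then have u: "sigma0 P * gamma1 P ^ n * gamma2 P ^ u \<le> sigma_max P L2" "k \<le> 2 * (n + u)"
    by linarith+
  have pos: "0 < sigma0 P" "0 < gamma1 P" "gamma1 P < 1" "1 < gamma2 P"
    using P by (auto simp: valid_params_def)
  have "gamma1 P ^ n * gamma2 P ^ u \<le> sigma_max P L2 / sigma0 P"
    using u(1) pos by (simp add: field_simps)
  then have "ln (gamma1 P ^ n * gamma2 P ^ u) \<le> ln (sigma_max P L2 / sigma0 P)"
    using pos by (subst ln_le_cancel_iff) (auto intro: less_le_trans[rotated])
  then have "n * ln (gamma1 P) + u * ln (gamma2 P) \<le> ln (sigma_max P L2 / sigma0 P)"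
    using pos by (simp add: ln_mult ln_realpow)
  then have "u * ln (gamma2 P) \<le> n * \<bar>ln (gamma1 P)\<bar> + ln (sigma_max P L2 / sigma0 P)"
    using pos by (simp add: abs_if)
  then have "u \<le> (n * \<bar>ln (gamma1 P)\<bar> + ln (sigma_max P L2 / sigma0 P)) / ln (gamma2 P)"
    using pos by (simp add: pos_le_divide_eq)
  moreover define r b where "r = \<bar>ln (gamma1 P)\<bar> / ln (gamma2 P)"
    and "b = ln (sigma_max P L2 / sigma0 P) / ln (gamma2 P)"
  ultimately have "u \<le> n * r + b" by (simp add: add_divide_distrib)
  moreover have "real k \<le> 2 * (real n + real u)" using of_nat_mono[OF u(2), where 'a = real] by simp
  ultimately show ?B unfolding n_def[symmetric] r_def[symmetric] b_def[symmetric] by (simp add: algebra_simps)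
qed

section \<open>Choice of the constant and the complexity bound\<close>

lemma grad_eq_0_at_minimum:
  fixes f :: "real^'n \<Rightarrow> real"
  assumes "f differentiable at x" and "\<And>y. f x \<le> f y"
  shows "grad f x = 0"
proof -
  have "(f has_derivative (\<lambda>h. h \<bullet> grad f x)) (at x)"
    using GDERIV_grad[OF assms(1)] by (simp add: gderiv_def inner_commute)
  then have "(\<lambda>h. h \<bullet> grad f x) = (\<lambda>h. 0)"
    by (rule differential_zero_maxmin[of x UNIV, rotated 2]) (use assms(2) in auto)
  then show ?thesis by (metis inner_eq_zero_iff)
qed

theorem theorem4p5:
  fixes f :: "real^'n \<Rightarrow> real" and x0 :: "real^'n" and L1 L2 f_low :: real
    and P :: far2_params
  assumes "AS1 f L1 L2" and "AS2 f f_low" and "valid_params TYPE('n) P"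
  shows "\<exists>\<kappa>\<^sub>p>0. \<forall>\<epsilon>\<in>{0<..<1}. \<forall>S succ. far2_run P f x0 \<epsilon> S succ \<longrightarrow>
    (\<exists>k. norm (grad f (iterate (S k))) \<le> \<epsilon> \<and>
         (\<forall>i<k. \<not> norm (grad f (iterate (S i))) \<le> \<epsilon>) \<and>
         int (card {i. i < k \<and> succ i}) \<le> \<lceil>(f x0 - f_low) / \<kappa>\<^sub>p * \<epsilon> powr (-3/2) + 1\<rceil> \<and>
         real k \<le> real_of_int \<lceil>(f x0 - f_low) / \<kappa>\<^sub>p * \<epsilon> powr (-3/2) + 1\<rceil>
                    * (3/2 + 3/2 * (\<bar>ln (gamma1 P)\<bar> / ln (gamma2 P)))
                  + 3 / (2 * ln (gamma2 P)) * ln (sigma_max P L2 / sigma0 P))"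
proof -
  define D where "D = f x0 - f_low"
  define \<kappa> where "\<kappa> = sufficient_decrease P L2"
  define r where "r = \<bar>ln (gamma1 P)\<bar> / ln (gamma2 P)"
  define b where "b = ln (sigma_max P L2 / sigma0 P) / ln (gamma2 P)"
  \<comment> \<open>With \<open>D / Q\<close> as constant, the coefficient in the ceiling becomes
    \<open>Q\<close>. The factor 4/3 turns 3/2 into 2, and \<open>b / 3\<close> supplies the missing
    \<open>b / 2\<close>.\<close>
  define Q where "Q = 4/3 * (D / \<kappa> + 1) + b / 3"
  have \<gamma>: "0 < gamma1 P" "gamma1 P < 1" "1 < gamma2 P" and s0: "0 < sigma0 P"
    using assms(3) by (auto simp: valid_params_def)
  have \<kappa>: "0 < \<kappa>"
    unfolding \<kappa>_def by (rule sufficient_decrease_pos[OF assms(3) AS1_L2_nonneg[OF assms(1)]])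
  have r: "0 \<le> r" unfolding r_def using \<gamma> by (intro divide_nonneg_nonneg) auto
  have b: "0 \<le> b"
    using \<gamma> s0 sigma_max_ge_sigma0[of P L2] by (auto simp: b_def intro!: divide_nonneg_pos ln_ge_zero)
  have D: "0 \<le> D" using assms(2) by (simp add: D_def AS2_def)
  have Q: "0 < Q" unfolding Q_def using D \<kappa> b by (intro add_pos_nonneg mult_pos_pos add_nonneg_pos) auto
  have eqb: "3 / (2 * ln (gamma2 P)) * ln (sigma_max P L2 / sigma0 P) = 3/2 * b"
    by (simp add: b_def)
  show ?thesis
  proof (cases "D = 0")
    case True
    \<comment> \<open>Here \<open>f\<close> attains its lower bound at \<open>x0\<close>, so the run
      stops at index 0 and the constant 1 serves.\<close>
    have "grad f x0 = 0"
      using assms True by (intro grad_eq_0_at_minimum)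
        (auto simp: AS1_def AS2_def twice_cont_differentiable_def D_def)
    then show ?thesis
      unfolding D_def[symmetric] True r_def[symmetric] eqb using r b
      by (intro exI[of _ 1]) (auto simp: far2_run_def intro!: exI[of _ "0::nat"])
  next
    case False
    then have "0 < D" using D by simp
    show ?thesis
      unfolding D_def[symmetric] r_def[symmetric] eqb
    proof (intro exI[of _ "D / Q"] conjI ballI allI impI)
      show "0 < D / Q" using \<open>0 < D\<close> Q by simp
      fix \<epsilon> :: real and S succ
      assume "\<epsilon> \<in> {0<..<1}" and run: "far2_run P f x0 \<epsilon> S succ"
      then have \<epsilon>: "0 < \<epsilon>" "\<epsilon> < 1" by auto
      define E where "E = \<epsilon> powr (-3/2)"
      have E: "1 \<le> E"
        using powr_mono2'[of "-3/2" \<epsilon> 1] \<epsilon> by (simp add: E_def)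
      have DQ: "D / (D / Q) = Q" using \<open>0 < D\<close> Q by simp
      define N where "N = \<lceil>Q * E + 1\<rceil>"
      have N: "Q * E \<le> N" unfolding N_def by linarith
      have QE: "4/3 * (D / \<kappa> * E + 1) + b / 3 \<le> Q * E"
      proof -
        \<comment> \<open>As \<open>E\<close> is at least 1, the terms independent of
          \<open>\<epsilon>\<close> may be multiplied by \<open>E\<close> and so absorbed into
          \<open>Q * E\<close>.\<close>
        have "4/3 * (D / \<kappa> * E + 1) + b / 3 \<le> 4/3 * (D / \<kappa> * E + E) + b / 3 * E"
          using E b mult_left_mono[OF E, of "b / 3"] by argo
        then show ?thesis by (simp add: Q_def algebra_simps)
      qed
      have bounds: "real (card {i. i < k \<and> succ i}) \<le> D / \<kappa> * E + 1"
          "real k \<le> 2 * (1 + r) * card {i. i < k \<and> succ i} + 2 * b"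
        if "\<forall>i<k. \<not> norm (grad f (iterate (S i))) \<le> \<epsilon>" for k
        using far2_run_bounds[OF assms \<epsilon>(1) run that]
        by (simp_all add: D_def \<kappa>_def E_def r_def b_def)
      have DE: "0 \<le> D / \<kappa> * E" using D \<kappa> E by simp
      have card_le: "real (card {i. i < k \<and> succ i}) \<le> N"
        if "\<forall>i<k. \<not> norm (grad f (iterate (S i))) \<le> \<epsilon>" for k
        using bounds(1)[OF that] N QE b DE by argo
      have k_le: "real k \<le> N * (3/2 + 3/2 * r) + 3/2 * b"
        if act: "\<forall>i<k. \<not> norm (grad f (iterate (S i))) \<le> \<epsilon>" for k
      proof -
        \<comment> \<open>The two sides differ by exactly \<open>r * b / 2\<close>.\<close>
        have aux: "2 * (1 + r) * X + 2 * b \<le> 3/2 * (1 + r) * (4/3 * X + b / 3) + 3/2 * b" for X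
          using mult_nonneg_nonneg[OF r b] by (simp add: field_simps)
        have "real k \<le> 2 * (1 + r) * card {i. i < k \<and> succ i} + 2 * b" by (rule bounds(2)[OF act])
        also have "\<dots> \<le> 2 * (1 + r) * (D / \<kappa> * E + 1) + 2 * b"
          using bounds(1)[OF act] r by (intro add_right_mono mult_left_mono) auto
        also have "\<dots> \<le> 3/2 * (1 + r) * (4/3 * (D / \<kappa> * E + 1) + b / 3) + 3/2 * b"
          by (rule aux)
        also have "\<dots> \<le> 3/2 * (1 + r) * N + 3/2 * b"
          using QE N r by (intro add_right_mono mult_left_mono) auto
        finally show ?thesis by (simp add: field_simps)
      qed
      have "\<exists>k. norm (grad f (iterate (S k))) \<le> \<epsilon>"
      proof (rule ccontr)
        assume "\<not> ?thesis"
        \<comment> \<open>Without termination the bound, which does not depend on \<open>k\<close>,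
          would hold for all natural numbers.\<close>
        then have "real k \<le> N * (3/2 + 3/2 * r) + 3/2 * b" for k using k_le by blast
        then show False using reals_Archimedean2 by (meson not_less)
      qed
      then obtain k where k: "norm (grad f (iterate (S k))) \<le> \<epsilon>"
        "\<forall>i<k. \<not> norm (grad f (iterate (S i))) \<le> \<epsilon>"
        using exists_least_iff[of "\<lambda>k. norm (grad f (iterate (S k))) \<le> \<epsilon>"] by blast
      moreover have "int (card {i. i < k \<and> succ i}) \<le> N" using card_le[OF k(2)] by linarith
      ultimately show "\<exists>k. norm (grad f (iterate (S k))) \<le> \<epsilon> \<and>
         (\<forall>i<k. \<not> norm (grad f (iterate (S i))) \<le> \<epsilon>) \<and>
         int (card {i. i < k \<and> succ i}) \<le> \<lceil>D / (D / Q) * \<epsilon> powr (-3/2) + 1\<rceil> \<and>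
         real k \<le> real_of_int \<lceil>D / (D / Q) * \<epsilon> powr (-3/2) + 1\<rceil> * (3/2 + 3/2 * r) + 3/2 * b"
        unfolding DQ E_def[symmetric] N_def[symmetric] using k_le by blast
    qed
  qed
qed

end
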